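(* Let $(\mathcal R,\otimes,I)$ be a closed 2-rig such that the functor $\mathcal R(I,-):\mathcal R\to\mathsf{Set}$ is faithful. Then any functor $\partial:\mathcal R\to\mathcal R$ can carry at most one left strength and at most one right strength.
   Context: A 2-rig (for a 2-rig doctrine) is a monoidal category $(\mathcal R,\otimes,I)$, possibly with additional structure of a multiplicative doctrine, having all colimits of a prescribed class of shapes that includes all finite discrete diagrams, such that $\otimes$ preserves these colimits in each variable separately; by default the class consists of finite coproducts only. It is closed if each functor $A\otimes-$ and each functor $-\otimes B$ has a right adjoint. A left strength on a functor $F:\mathcal R\to\mathcal R$ is a family of maps $R\otimes FC\to F(R\otimes C)$ natural in $R$ and $C$ and satisfying the usual unit and associativity axioms of a tensorial strength; a right strength is a family $FC\otimes R\to F(C\otimes R)$ satisfying the analogous axioms. *)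

theory Defs
  imports Main "HOL-Library.FuncSet"
begin

section \<open>Categories and functors\<close>

record ('o, 'm) category =
  Obj :: "'o set"
  Arr :: "'m set"
  Dom :: "'m \<Rightarrow> 'o"
  Cod :: "'m \<Rightarrow> 'o"
  Id :: "'o \<Rightarrow> 'm"
  Comp :: "'m \<Rightarrow> 'm \<Rightarrow> 'm" (infixr "\<cdot>\<index>" 70)

definition Hom :: "('o, 'm, 'z) category_scheme \<Rightarrow> 'o \<Rightarrow> 'o \<Rightarrow> 'm set" where
  "Hom C A B = {f \<in> Arr C. Dom C f = A \<and> Cod C f = B}"

locale category =
  fixes C :: "('o, 'm, 'z) category_scheme" (structure)
  assumes dom_obj: "f \<in> Arr C \<Longrightarrow> Dom C f \<in> Obj C"
    and cod_obj: "f \<in> Arr C \<Longrightarrow> Cod C f \<in> Obj C"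
    and id_hom: "A \<in> Obj C \<Longrightarrow> Id C A \<in> Hom C A A"
    and comp_hom: "g \<in> Hom C A B \<Longrightarrow> f \<in> Hom C B D \<Longrightarrow> f \<cdot> g \<in> Hom C A D"
    and id_left: "f \<in> Hom C A B \<Longrightarrow> Id C B \<cdot> f = f"
    and id_right: "f \<in> Hom C A B \<Longrightarrow> f \<cdot> Id C A = f"
    and comp_assoc: "f \<in> Hom C A B \<Longrightarrow> g \<in> Hom C B D \<Longrightarrow> h \<in> Hom C D E
          \<Longrightarrow> (h \<cdot> g) \<cdot> f = h \<cdot> (g \<cdot> f)"

definition is_iso :: "('o, 'm, 'z) category_scheme \<Rightarrow> 'o \<Rightarrow> 'o \<Rightarrow> 'm \<Rightarrow> bool" where
  "is_iso C A B f \<longleftrightarrow> f \<in> Hom C A B \<and>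
     (\<exists>g \<in> Hom C B A. Comp C g f = Id C A \<and> Comp C f g = Id C B)"

record ('o, 'm, 'p, 'n) fmap =
  on_obj :: "'o \<Rightarrow> 'p"
  on_arr :: "'m \<Rightarrow> 'n"

locale is_functor = dom: category C + cod: category D
  for C :: "('o, 'm, 'z) category_scheme" and D :: "('p, 'n, 'y) category_scheme" +
  fixes F :: "('o, 'm, 'p, 'n) fmap"
  assumes obj_map: "A \<in> Obj C \<Longrightarrow> on_obj F A \<in> Obj D"
    and hom_map: "f \<in> Hom C A B \<Longrightarrow> on_arr F f \<in> Hom D (on_obj F A) (on_obj F B)"
    and id_map: "A \<in> Obj C \<Longrightarrow> on_arr F (Id C A) = Id D (on_obj F A)"
    and comp_map: "f \<in> Hom C A B \<Longrightarrow> g \<in> Hom C B E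
          \<Longrightarrow> on_arr F (Comp C g f) = Comp D (on_arr F g) (on_arr F f)"

locale faithful_functor = is_functor +
  assumes faithful: "f \<in> Hom C A B \<Longrightarrow> g \<in> Hom C A B \<Longrightarrow> on_arr F f = on_arr F g \<Longrightarrow> f = g"

definition comp_fmap ::
    "('p, 'n, 'q, 'k) fmap \<Rightarrow> ('o, 'm, 'p, 'n) fmap \<Rightarrow> ('o, 'm, 'q, 'k) fmap" where
  "comp_fmap G F = \<lparr>on_obj = on_obj G \<circ> on_obj F, on_arr = on_arr G \<circ> on_arr F\<rparr>"

definition prod_cat ::
    "('o, 'm, 'z) category_scheme \<Rightarrow> ('p, 'n, 'y) category_scheme
      \<Rightarrow> ('o \<times> 'p, 'm \<times> 'n) category" where
  "prod_cat C D = \<lparr>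
     Obj = Obj C \<times> Obj D,
     Arr = Arr C \<times> Arr D,
     Dom = (\<lambda>(f, g). (Dom C f, Dom D g)),
     Cod = (\<lambda>(f, g). (Cod C f, Cod D g)),
     Id = (\<lambda>(A, B). (Id C A, Id D B)),
     Comp = (\<lambda>(f', g') (f, g). (Comp C f' f, Comp D g' g))\<rparr>"

text \<open>The category of the subsets of a type \<open>'a\<close>. A map is stored together with its source and
  target, and takes the value \<open>undefined\<close> outside its source, so that equality of arrows is
  equality of maps between sets.\<close>

definition set_cat :: "('a set, 'a set \<times> ('a \<Rightarrow> 'a) \<times> 'a set) category" where
  "set_cat = \<lparr>
     Obj = UNIV,
     Arr = {(A, f, B). f \<in> A \<rightarrow>\<^sub>E B},
     Dom = (\<lambda>(A, f, B). A),
     Cod = (\<lambda>(A, f, B). B),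
     Id = (\<lambda>A. (A, restrict (\<lambda>x. x) A, A)),
     Comp = (\<lambda>(B', g, D) (A, f, B). (A, compose A g f, D))\<rparr>"

text \<open>The representable functor at \<open>X\<close>, sending \<open>f\<close> to postcomposition with \<open>f\<close>.\<close>

definition hom_functor :: "('o, 'm, 'z) category_scheme \<Rightarrow> 'o
    \<Rightarrow> ('o, 'm, 'm set, 'm set \<times> ('m \<Rightarrow> 'm) \<times> 'm set) fmap" where
  "hom_functor C X = \<lparr>
     on_obj = Hom C X,
     on_arr = (\<lambda>f. (Hom C X (Dom C f), restrict (Comp C f) (Hom C X (Dom C f)),
                    Hom C X (Cod C f)))\<rparr>"

lemma set_cat_category: "category set_cat"
proof
qed (auto simp: set_cat_def Hom_def compose_def fun_eq_iff PiE_def extensional_def)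

text \<open>Functoriality of \<open>hom_functor C X\<close> holds for every object \<open>X\<close>, so
  \<open>faithful_functor C set_cat (hom_functor C X)\<close> assumes nothing beyond faithfulness.\<close>

lemma hom_functor_is_functor:
  assumes "category C" "X \<in> Obj C"
  shows "is_functor C set_cat (hom_functor C X)"
proof -
  interpret category C by fact
  interpret S: category set_cat by (rule set_cat_category)
  show ?thesis
  proof
    show "\<And>A. on_obj (hom_functor C X) A \<in> Obj set_cat" by (simp add: set_cat_def)
    show "\<And>f A B. f \<in> Hom C A B \<Longrightarrow> on_arr (hom_functor C X) f \<in> Hom set_cat (on_obj (hom_functor C X) A) (on_obj (hom_functor C X) B)"
      using comp_hom by (auto simp: set_cat_def hom_functor_def Hom_def)
    show "\<And>A. A \<in> Obj C \<Longrightarrow> on_arr (hom_functor C X) (Id C A) = Id set_cat (on_obj (hom_functor C X) A)"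
      using id_hom id_left by (auto simp: set_cat_def hom_functor_def Hom_def fun_eq_iff restrict_def)
    fix f g A B E assume fg: "f \<in> Hom C A B" "g \<in> Hom C B E"
    have "Comp C g f \<in> Hom C A E" using comp_hom fg by blast
    then show "on_arr (hom_functor C X) (Comp C g f) = Comp set_cat (on_arr (hom_functor C X) g) (on_arr (hom_functor C X) f)"
      using fg comp_hom[of _ X A f B] comp_assoc[of _ X A f B g E]
      by (auto simp: set_cat_def hom_functor_def Hom_def fun_eq_iff restrict_def compose_def)
  qed
qed

definition adjoint_pair :: "('o, 'm, 'z) category_scheme \<Rightarrow> ('p, 'n, 'y) category_scheme
    \<Rightarrow> ('o, 'm, 'p, 'n) fmap \<Rightarrow> ('p, 'n, 'o, 'm) fmap \<Rightarrow> bool" where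
  "adjoint_pair C D F G \<longleftrightarrow> is_functor C D F \<and> is_functor D C G \<and>
     (\<exists>\<phi>. (\<forall>X \<in> Obj C. \<forall>Y \<in> Obj D.
              bij_betw (\<phi> X Y) (Hom D (on_obj F X) Y) (Hom C X (on_obj G Y))) \<and>
          (\<forall>X \<in> Obj C. \<forall>X' \<in> Obj C. \<forall>Y \<in> Obj D. \<forall>Y' \<in> Obj D.
             \<forall>f \<in> Hom C X' X. \<forall>g \<in> Hom D Y Y'. \<forall>h \<in> Hom D (on_obj F X) Y.
               \<phi> X' Y' (Comp D g (Comp D h (on_arr F f)))
                 = Comp C (on_arr G g) (Comp C (\<phi> X Y h) f)))"

definition has_right_adjoint :: "('o, 'm, 'z) category_scheme \<Rightarrow> ('p, 'n, 'y) category_scheme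
    \<Rightarrow> ('o, 'm, 'p, 'n) fmap \<Rightarrow> bool" where
  "has_right_adjoint C D F \<longleftrightarrow> (\<exists>G. adjoint_pair C D F G)"


section \<open>Colimits\<close>

definition is_cocone :: "('i, 'j, 'x) category_scheme \<Rightarrow> ('o, 'm, 'z) category_scheme
    \<Rightarrow> ('i, 'j, 'o, 'm) fmap \<Rightarrow> 'o \<Rightarrow> ('i \<Rightarrow> 'm) \<Rightarrow> bool" where
  "is_cocone J C T X \<iota> \<longleftrightarrow> X \<in> Obj C \<and>
     (\<forall>j \<in> Obj J. \<iota> j \<in> Hom C (on_obj T j) X) \<and>
     (\<forall>u \<in> Arr J. Comp C (\<iota> (Cod J u)) (on_arr T u) = \<iota> (Dom J u))"

definition is_colimit :: "('i, 'j, 'x) category_scheme \<Rightarrow> ('o, 'm, 'z) category_scheme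
    \<Rightarrow> ('i, 'j, 'o, 'm) fmap \<Rightarrow> 'o \<Rightarrow> ('i \<Rightarrow> 'm) \<Rightarrow> bool" where
  "is_colimit J C T X \<iota> \<longleftrightarrow> is_cocone J C T X \<iota> \<and>
     (\<forall>Y \<kappa>. is_cocone J C T Y \<kappa> \<longrightarrow>
        (\<exists>!h. h \<in> Hom C X Y \<and> (\<forall>j \<in> Obj J. Comp C h (\<iota> j) = \<kappa> j)))"

definition has_colimits :: "('i, 'j, 'x) category_scheme \<Rightarrow> ('o, 'm, 'z) category_scheme \<Rightarrow> bool"
  where "has_colimits J C \<longleftrightarrow> (\<forall>T. is_functor J C T \<longrightarrow> (\<exists>X \<iota>. is_colimit J C T X \<iota>))"

definition preserves_colimits :: "('i, 'j, 'x) category_scheme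
    \<Rightarrow> ('o, 'm, 'z) category_scheme \<Rightarrow> ('p, 'n, 'y) category_scheme
    \<Rightarrow> ('o, 'm, 'p, 'n) fmap \<Rightarrow> bool" where
  "preserves_colimits J C D F \<longleftrightarrow>
     (\<forall>T X \<iota>. is_functor J C T \<and> is_colimit J C T X \<iota> \<longrightarrow>
        is_colimit J D (comp_fmap F T) (on_obj F X) (\<lambda>j. on_arr F (\<iota> j)))"

definition discrete_cat :: "('o, 'm, 'z) category_scheme \<Rightarrow> bool" where
  "discrete_cat J \<longleftrightarrow> category J \<and> Arr J = Id J ` Obj J"


section \<open>Monoidal categories and 2-rigs\<close>

record ('o, 'm) monoidal_category = "('o, 'm) category" +
  tens_obj :: "'o \<Rightarrow> 'o \<Rightarrow> 'o" (infixr "\<otimes>\<index>" 75)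
  tens_arr :: "'m \<Rightarrow> 'm \<Rightarrow> 'm" (infixr "\<boxtimes>\<index>" 75)
  unit_obj :: "'o" ("\<one>\<index>")
  associator :: "'o \<Rightarrow> 'o \<Rightarrow> 'o \<Rightarrow> 'm" ("\<a>\<index>")
  left_unitor :: "'o \<Rightarrow> 'm" ("\<l>\<index>")
  right_unitor :: "'o \<Rightarrow> 'm" ("\<r>\<index>")

definition tensor_functor :: "('o, 'm, 'z) monoidal_category_scheme
    \<Rightarrow> ('o \<times> 'o, 'm \<times> 'm, 'o, 'm) fmap" where
  "tensor_functor R = \<lparr>on_obj = (\<lambda>(A, B). tens_obj R A B), on_arr = (\<lambda>(f, g). tens_arr R f g)\<rparr>"

definition tensor_left :: "('o, 'm, 'z) monoidal_category_scheme \<Rightarrow> 'o \<Rightarrow> ('o, 'm, 'o, 'm) fmap"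
  where "tensor_left R A = \<lparr>on_obj = (\<lambda>X. tens_obj R A X), on_arr = (\<lambda>f. tens_arr R (Id R A) f)\<rparr>"

definition tensor_right :: "('o, 'm, 'z) monoidal_category_scheme \<Rightarrow> 'o \<Rightarrow> ('o, 'm, 'o, 'm) fmap"
  where "tensor_right R B = \<lparr>on_obj = (\<lambda>X. tens_obj R X B), on_arr = (\<lambda>f. tens_arr R f (Id R B))\<rparr>"

locale monoidal_category = category R
  for R :: "('o, 'm, 'z) monoidal_category_scheme" (structure) +
  assumes tensor_functor: "is_functor (prod_cat R R) R (tensor_functor R)"
    and unit_obj: "\<one> \<in> Obj R"
    and assoc_iso: "A \<in> Obj R \<Longrightarrow> B \<in> Obj R \<Longrightarrow> C \<in> Obj R
          \<Longrightarrow> is_iso R ((A \<otimes> B) \<otimes> C) (A \<otimes> (B \<otimes> C)) (\<a> A B C)"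
    and assoc_nat: "f \<in> Hom R A A' \<Longrightarrow> g \<in> Hom R B B' \<Longrightarrow> h \<in> Hom R C C'
          \<Longrightarrow> (f \<boxtimes> (g \<boxtimes> h)) \<cdot> \<a> A B C = \<a> A' B' C' \<cdot> ((f \<boxtimes> g) \<boxtimes> h)"
    and lunit_iso: "A \<in> Obj R \<Longrightarrow> is_iso R (\<one> \<otimes> A) A (\<l> A)"
    and lunit_nat: "f \<in> Hom R A B \<Longrightarrow> f \<cdot> \<l> A = \<l> B \<cdot> (Id R \<one> \<boxtimes> f)"
    and runit_iso: "A \<in> Obj R \<Longrightarrow> is_iso R (A \<otimes> \<one>) A (\<r> A)"
    and runit_nat: "f \<in> Hom R A B \<Longrightarrow> f \<cdot> \<r> A = \<r> B \<cdot> (f \<boxtimes> Id R \<one>)"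
    and triangle: "A \<in> Obj R \<Longrightarrow> B \<in> Obj R
          \<Longrightarrow> (Id R A \<boxtimes> \<l> B) \<cdot> \<a> A \<one> B = \<r> A \<boxtimes> Id R B"
    and pentagon: "A \<in> Obj R \<Longrightarrow> B \<in> Obj R \<Longrightarrow> C \<in> Obj R \<Longrightarrow> E \<in> Obj R
          \<Longrightarrow> (Id R A \<boxtimes> \<a> B C E) \<cdot> \<a> A (B \<otimes> C) E \<cdot> (\<a> A B C \<boxtimes> Id R E)
              = \<a> A B (C \<otimes> E) \<cdot> \<a> (A \<otimes> B) C E"

text \<open>The set \<open>\<J>\<close> is the prescribed class of shapes. Having colimits of a shape is invariant
  under isomorphism of shapes, so finite discrete shapes are only required up to isomorphism,
  that is, one for each cardinality. Further structure of a multiplicative doctrine (a symmetry,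
  for instance) lives in the extension slot \<open>'z\<close> of the record type of \<open>R\<close>.\<close>

locale two_rig = monoidal_category R
  for R :: "('o, 'm, 'z) monoidal_category_scheme" (structure) +
  fixes \<J> :: "('i, 'j) category set"
  assumes shape_category: "J \<in> \<J> \<Longrightarrow> category J"
    and finite_discrete: "\<And>n :: nat. \<exists>J \<in> \<J>. discrete_cat J \<and> finite (Obj J) \<and> card (Obj J) = n"
    and has_colimits: "J \<in> \<J> \<Longrightarrow> has_colimits J R"
    and tensor_left_colimits: "J \<in> \<J> \<Longrightarrow> A \<in> Obj R \<Longrightarrow> preserves_colimits J R R (tensor_left R A)"
    and tensor_right_colimits: "J \<in> \<J> \<Longrightarrow> B \<in> Obj R \<Longrightarrow> preserves_colimits J R R (tensor_right R B)"

locale closed_two_rig = two_rig +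
  assumes left_closed: "A \<in> Obj R \<Longrightarrow> has_right_adjoint R R (tensor_left R A)"
    and right_closed: "B \<in> Obj R \<Longrightarrow> has_right_adjoint R R (tensor_right R B)"


section \<open>Strengths\<close>

locale left_strength = monoidal_category R + is_functor R R F
  for R :: "('o, 'm, 'z) monoidal_category_scheme" (structure) and F :: "('o, 'm, 'o, 'm) fmap" +
  fixes t :: "'o \<Rightarrow> 'o \<Rightarrow> 'm"
  assumes strength_hom: "A \<in> Obj R \<Longrightarrow> C \<in> Obj R
          \<Longrightarrow> t A C \<in> Hom R (A \<otimes> on_obj F C) (on_obj F (A \<otimes> C))"
    and strength_nat: "f \<in> Hom R A A' \<Longrightarrow> g \<in> Hom R C C'
          \<Longrightarrow> on_arr F (f \<boxtimes> g) \<cdot> t A C = t A' C' \<cdot> (f \<boxtimes> on_arr F g)"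
    and strength_unit: "C \<in> Obj R \<Longrightarrow> on_arr F (\<l> C) \<cdot> t \<one> C = \<l> (on_obj F C)"
    and strength_assoc: "A \<in> Obj R \<Longrightarrow> B \<in> Obj R \<Longrightarrow> C \<in> Obj R
          \<Longrightarrow> on_arr F (\<a> A B C) \<cdot> t (A \<otimes> B) C
              = t A (B \<otimes> C) \<cdot> (Id R A \<boxtimes> t B C) \<cdot> \<a> A B (on_obj F C)"

text \<open>The component \<open>t C A\<close> of a right strength is a map \<open>F C \<otimes> A \<rightarrow> F (C \<otimes> A)\<close>.\<close>

locale right_strength = monoidal_category R + is_functor R R F
  for R :: "('o, 'm, 'z) monoidal_category_scheme" (structure) and F :: "('o, 'm, 'o, 'm) fmap" +
  fixes t :: "'o \<Rightarrow> 'o \<Rightarrow> 'm"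
  assumes strength_hom: "C \<in> Obj R \<Longrightarrow> A \<in> Obj R
          \<Longrightarrow> t C A \<in> Hom R (on_obj F C \<otimes> A) (on_obj F (C \<otimes> A))"
    and strength_nat: "g \<in> Hom R C C' \<Longrightarrow> f \<in> Hom R A A'
          \<Longrightarrow> on_arr F (g \<boxtimes> f) \<cdot> t C A = t C' A' \<cdot> (on_arr F g \<boxtimes> f)"
    and strength_unit: "C \<in> Obj R \<Longrightarrow> on_arr F (\<r> C) \<cdot> t C \<one> = \<r> (on_obj F C)"
    and strength_assoc: "C \<in> Obj R \<Longrightarrow> A \<in> Obj R \<Longrightarrow> B \<in> Obj R
          \<Longrightarrow> on_arr F (\<a> C A B) \<cdot> t (C \<otimes> A) B \<cdot> (t C A \<boxtimes> Id R B)
              = t C (A \<otimes> B) \<cdot> \<a> (on_obj F C) A B"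

end

theory Submission
  imports Defs
begin

text \<open>
  Under the hypotheses of the theorem a strength is determined by its components at the unit, and
  those are forced by the unit axiom. Let \<open>t\<close> be a left strength on \<open>F\<close>. As \<open>F (\<l> C)\<close> is invertible, the unit axiom
  leaves only one choice for \<open>t \<one> C\<close>. Naturality along a global element \<open>a : \<one> \<rightarrow> A\<close> then gives
  \<open>t A C \<cdot> (a \<boxtimes> id) = F (a \<boxtimes> id) \<cdot> t \<one> C\<close>, so that two left strengths have the same composite with
  \<open>a \<boxtimes> id\<close> for every \<open>a\<close>.

  It remains to see that maps out of \<open>A \<otimes> F C\<close> are separated by the maps \<open>a \<boxtimes> id\<close>. Faithfulness
  of \<open>Hom(\<one>, -)\<close> says that maps out of \<open>A\<close> are separated by the global elements of \<open>A\<close>. Closedness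
  carries this over to \<open>A \<otimes> F C\<close>: transposing along the adjunction \<open>- \<otimes> F C \<stileturn> G\<close> turns
  precomposition with \<open>a \<boxtimes> id\<close> into precomposition with \<open>a\<close> (\<open>left_adjoint_separating\<close>). Right
  strengths are treated in the same way, with the right adjoint of \<open>F C \<otimes> -\<close>.
\<close>

lemma iso_left_cancel:
  assumes "category C" "is_iso C A B m" "f \<in> Hom C X A" "g \<in> Hom C X A"
    and eq: "Comp C m f = Comp C m g"
  shows "f = g"
proof -
  interpret category C by fact
  obtain n where m: "m \<in> Hom C A B" and n: "n \<in> Hom C B A" and nm: "Comp C n m = Id C A"
    using assms(2) by (auto simp: is_iso_def)
  have "f = Comp C n (Comp C m f)"
    using comp_assoc[OF assms(3) m n] nm id_left[OF assms(3)] by simp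
  also have "\<dots> = Comp C n (Comp C m g)"
    by (simp only: eq)
  also have "\<dots> = g"
    using comp_assoc[OF assms(4) m n] nm id_left[OF assms(4)] by simp
  finally show ?thesis .
qed

lemma is_functor_is_iso:
  assumes "is_functor C D F" "is_iso C A B m"
  shows "is_iso D (on_obj F A) (on_obj F B) (on_arr F m)"
proof -
  interpret is_functor C D F by fact
  obtain n where m: "m \<in> Hom C A B" and n: "n \<in> Hom C B A"
    and inv: "Comp C n m = Id C A" "Comp C m n = Id C B"
    using assms(2) by (auto simp: is_iso_def)
  have "A \<in> Obj C" "B \<in> Obj C"
    using m dom.dom_obj dom.cod_obj by (auto simp: Hom_def)
  with inv have "Comp D (on_arr F n) (on_arr F m) = Id D (on_obj F A)"
    and "Comp D (on_arr F m) (on_arr F n) = Id D (on_obj F B)"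
    using comp_map[OF m n] comp_map[OF n m] id_map by auto
  then show ?thesis
    using hom_map[OF m] hom_map[OF n] by (auto simp: is_iso_def)
qed

lemma faithful_hom_functor_separating:
  assumes "faithful_functor C S (hom_functor C X)"
    and f: "f \<in> Hom C A B" and g: "g \<in> Hom C A B"
    and eq: "\<And>a. a \<in> Hom C X A \<Longrightarrow> Comp C f a = Comp C g a"
  shows "f = g"
proof -
  have "on_arr (hom_functor C X) f = on_arr (hom_functor C X) g"
    using f g eq by (auto simp: hom_functor_def Hom_def intro!: restrict_ext)
  then show ?thesis
    using faithful_functor.faithful[OF assms(1) f g] by blast
qed

text \<open>The transpose of \<open>u \<cdot> F a\<close> is the transpose of \<open>u\<close> precomposed with \<open>a\<close>. So if \<open>u\<close> and \<open>v\<close>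
  agree after every \<open>F a\<close>, then their transposes agree on all generalized elements \<open>a\<close> of
  shape \<open>X\<close>, hence are equal.\<close>

lemma left_adjoint_separating:
  assumes faithful: "faithful_functor C S (hom_functor C X)"
    and adj: "has_right_adjoint C D F"
    and X: "X \<in> Obj C" and A: "A \<in> Obj C"
    and u: "u \<in> Hom D (on_obj F A) Y" and v: "v \<in> Hom D (on_obj F A) Y"
    and eq: "\<And>a. a \<in> Hom C X A \<Longrightarrow> Comp D u (on_arr F a) = Comp D v (on_arr F a)"
  shows "u = v"
proof -
  obtain G \<phi> where F: "is_functor C D F" and G: "is_functor D C G"
    and bij: "\<And>X Y. X \<in> Obj C \<Longrightarrow> Y \<in> Obj D
        \<Longrightarrow> bij_betw (\<phi> X Y) (Hom D (on_obj F X) Y) (Hom C X (on_obj G Y))"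
    and nat: "\<And>X X' Y Y' f g h. X \<in> Obj C \<Longrightarrow> X' \<in> Obj C \<Longrightarrow> Y \<in> Obj D \<Longrightarrow> Y' \<in> Obj D
        \<Longrightarrow> f \<in> Hom C X' X \<Longrightarrow> g \<in> Hom D Y Y' \<Longrightarrow> h \<in> Hom D (on_obj F X) Y
        \<Longrightarrow> \<phi> X' Y' (Comp D g (Comp D h (on_arr F f)))
            = Comp C (on_arr G g) (Comp C (\<phi> X Y h) f)"
    using adj unfolding has_right_adjoint_def adjoint_pair_def by metis
  interpret F: is_functor C D F by fact
  interpret G: is_functor D C G by fact
  have Y: "Y \<in> Obj D"
    using u F.cod.cod_obj by (auto simp: Hom_def)
  have \<phi>_hom: "\<phi> A Y h \<in> Hom C A (on_obj G Y)" if "h \<in> Hom D (on_obj F A) Y" for h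
    using bij_betw_apply[OF bij[OF A Y] that] .
  have transpose: "\<phi> X Y (Comp D h (on_arr F a)) = Comp C (\<phi> A Y h) a"
    if h: "h \<in> Hom D (on_obj F A) Y" and a: "a \<in> Hom C X A" for h a
  proof -
    have "Comp D h (on_arr F a) \<in> Hom D (on_obj F X) Y"
      using F.cod.comp_hom[OF F.hom_map[OF a] h] .
    moreover have "Comp C (\<phi> A Y h) a \<in> Hom C X (on_obj G Y)"
      using F.dom.comp_hom[OF a \<phi>_hom[OF h]] .
    ultimately show ?thesis
      using nat[OF A X Y Y a F.cod.id_hom[OF Y] h] G.id_map[OF Y]
        F.cod.id_left F.dom.id_left by metis
  qed
  have "\<phi> A Y u = \<phi> A Y v"
    using faithful \<phi>_hom[OF u] \<phi>_hom[OF v]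
  proof (rule faithful_hom_functor_separating)
    fix a assume a: "a \<in> Hom C X A"
    show "Comp C (\<phi> A Y u) a = Comp C (\<phi> A Y v) a"
      using transpose[OF u a] transpose[OF v a] eq[OF a] by simp
  qed
  then show ?thesis
    using bij[OF A Y] u v by (auto simp: bij_betw_def inj_on_def)
qed

lemma left_strength_unit_unique:
  assumes "left_strength R F s" "left_strength R F t" "C \<in> Obj R"
  shows "s (unit_obj R) C = t (unit_obj R) C"
proof -
  interpret S: left_strength R F s by fact
  interpret T: left_strength R F t by fact
  show ?thesis
    using S.strength_unit[OF assms(3)] T.strength_unit[OF assms(3)]
    by (intro iso_left_cancel[OF S.category_axioms
          is_functor_is_iso[OF S.is_functor_axioms S.lunit_iso[OF assms(3)]]
          S.strength_hom[OF S.unit_obj assms(3)] T.strength_hom[OF S.unit_obj assms(3)]]) simp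
qed

lemma right_strength_unit_unique:
  assumes "right_strength R F s" "right_strength R F t" "C \<in> Obj R"
  shows "s C (unit_obj R) = t C (unit_obj R)"
proof -
  interpret S: right_strength R F s by fact
  interpret T: right_strength R F t by fact
  show ?thesis
    using S.strength_unit[OF assms(3)] T.strength_unit[OF assms(3)]
    by (intro iso_left_cancel[OF S.category_axioms
          is_functor_is_iso[OF S.is_functor_axioms S.runit_iso[OF assms(3)]]
          S.strength_hom[OF assms(3) S.unit_obj] T.strength_hom[OF assms(3) S.unit_obj]]) simp
qed

lemma left_strength_unique:
  assumes faithful: "faithful_functor R S (hom_functor R (unit_obj R))"
    and closed: "\<And>B. B \<in> Obj R \<Longrightarrow> has_right_adjoint R R (tensor_right R B)"
    and s: "left_strength R F s" and t: "left_strength R F t"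
    and A: "A \<in> Obj R" and C: "C \<in> Obj R"
  shows "s A C = t A C"
proof -
  interpret S: left_strength R F s by fact
  interpret T: left_strength R F t by fact
  show ?thesis
  proof (rule left_adjoint_separating[OF faithful closed[OF S.obj_map[OF C]] S.unit_obj A])
    show "s A C \<in> Hom R (on_obj (tensor_right R (on_obj F C)) A) (on_obj F (tens_obj R A C))"
      and "t A C \<in> Hom R (on_obj (tensor_right R (on_obj F C)) A) (on_obj F (tens_obj R A C))"
      using S.strength_hom[OF A C] T.strength_hom[OF A C] by (simp_all add: tensor_right_def)
    fix a assume a: "a \<in> Hom R (unit_obj R) A"
    show "Comp R (s A C) (on_arr (tensor_right R (on_obj F C)) a)
        = Comp R (t A C) (on_arr (tensor_right R (on_obj F C)) a)"
      using S.strength_nat[OF a S.id_hom[OF C]] T.strength_nat[OF a S.id_hom[OF C]]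
        left_strength_unit_unique[OF s t C] S.id_map[OF C]
      by (simp add: tensor_right_def)
  qed
qed

lemma right_strength_unique:
  assumes faithful: "faithful_functor R S (hom_functor R (unit_obj R))"
    and closed: "\<And>B. B \<in> Obj R \<Longrightarrow> has_right_adjoint R R (tensor_left R B)"
    and s: "right_strength R F s" and t: "right_strength R F t"
    and C: "C \<in> Obj R" and A: "A \<in> Obj R"
  shows "s C A = t C A"
proof -
  interpret S: right_strength R F s by fact
  interpret T: right_strength R F t by fact
  show ?thesis
  proof (rule left_adjoint_separating[OF faithful closed[OF S.obj_map[OF C]] S.unit_obj A])
    show "s C A \<in> Hom R (on_obj (tensor_left R (on_obj F C)) A) (on_obj F (tens_obj R C A))"
      and "t C A \<in> Hom R (on_obj (tensor_left R (on_obj F C)) A) (on_obj F (tens_obj R C A))"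
      using S.strength_hom[OF C A] T.strength_hom[OF C A] by (simp_all add: tensor_left_def)
    fix a assume a: "a \<in> Hom R (unit_obj R) A"
    show "Comp R (s C A) (on_arr (tensor_left R (on_obj F C)) a)
        = Comp R (t C A) (on_arr (tensor_left R (on_obj F C)) a)"
      using S.strength_nat[OF S.id_hom[OF C] a] T.strength_nat[OF S.id_hom[OF C] a]
        right_strength_unit_unique[OF s t C] S.id_map[OF C]
      by (simp add: tensor_left_def)
  qed
qed

theorem proposition4p9:
  fixes R :: "('o, 'm, 'z) monoidal_category_scheme"
    and \<J> :: "('i, 'j) category set"
    and D :: "('o, 'm, 'o, 'm) fmap"
  assumes "closed_two_rig R \<J>"
    and "faithful_functor R set_cat (hom_functor R (unit_obj R))"
    and "is_functor R R D"
  shows "(\<forall>s t. left_strength R D s \<and> left_strength R D t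
            \<longrightarrow> (\<forall>A \<in> Obj R. \<forall>C \<in> Obj R. s A C = t A C)) \<and>
         (\<forall>s t. right_strength R D s \<and> right_strength R D t
            \<longrightarrow> (\<forall>C \<in> Obj R. \<forall>A \<in> Obj R. s C A = t C A))"
  using left_strength_unique[OF assms(2) closed_two_rig.right_closed[OF assms(1)]]
    right_strength_unique[OF assms(2) closed_two_rig.left_closed[OF assms(1)]]
  by blast

end
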